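(* For every integer $m\geq 5$, the discrete torus $C_m\mathbin{\square} C_m$ has $\operatorname{meg}(C_m\mathbin{\square} C_m)=3m$.
   Context: All graphs are finite and simple. $C_m$ denotes the cycle on $m$ vertices. The distance $\operatorname{dist}_G(u,v)$ is the length of a shortest path between $u$ and $v$ in $G$ (infinite if there is none). A set $S\subseteq V(G)$ monitors an edge $e\in E(G)$ if there are $u,v\in S$ with $\operatorname{dist}_{G-e}(u,v)\neq\operatorname{dist}_G(u,v)$, where $G-e$ is $G$ with the edge $e$ removed (its endpoints kept). A monitoring edge-geodetic set (MEG-set) of $G$ is a set of vertices that monitors every edge of $G$. The monitoring edge-geodetic number $\operatorname{meg}(G)$ is the minimum size of a MEG-set of $G$. The Cartesian product $G\mathbin{\square} H$ has vertex set $V(G)\times V(H)$, and its edges are the pairs $(a,b)(c,d)$ such that either $a=c$ and $bd\in E(H)$, or $b=d$ and $ac\in E(G)$. *)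

theory Defs
  imports "Graph_Theory.Graph_Theory"
begin

text \<open>
  Finite simple graphs are the instances of the locale \<^locale>\<open>pair_graph\<close>: finite, symmetric,
  loop-free relations on a vertex set.  An undirected edge is thus a pair of opposite arcs.
\<close>

definition del_edge :: "'a pair_pre_digraph \<Rightarrow> 'a \<times> 'a \<Rightarrow> 'a pair_pre_digraph" where
  "del_edge G e = \<lparr>pverts = pverts G, parcs = parcs G - {e, prod.swap e}\<rparr>"

text \<open>
  Distance in an unweighted graph is the library's shortest-path cost with unit arc weights;
  it is \<open>\<infinity>\<close> when there is no walk.
\<close>

definition graph_dist :: "'a pair_pre_digraph \<Rightarrow> 'a \<Rightarrow> 'a \<Rightarrow> ereal" where
  "graph_dist G u v = wf_digraph.\<mu> (with_proj G) (\<lambda>_. 1) u v"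

definition monitors :: "'a pair_pre_digraph \<Rightarrow> 'a set \<Rightarrow> 'a \<times> 'a \<Rightarrow> bool" where
  "monitors G S e \<longleftrightarrow> (\<exists>u\<in>S. \<exists>v\<in>S. graph_dist (del_edge G e) u v \<noteq> graph_dist G u v)"

definition MEG_set :: "'a pair_pre_digraph \<Rightarrow> 'a set \<Rightarrow> bool" where
  "MEG_set G S \<longleftrightarrow> S \<subseteq> pverts G \<and> (\<forall>e\<in>parcs G. monitors G S e)"

definition meg :: "'a pair_pre_digraph \<Rightarrow> nat" where
  "meg G = (LEAST k. \<exists>S. MEG_set G S \<and> card S = k)"

text \<open>This is the cycle \<open>C\<^sub>m\<close> for \<open>m \<ge> 3\<close>; smaller \<open>m\<close> do not give a cycle.\<close>

definition cycle_graph :: "nat \<Rightarrow> nat pair_pre_digraph" where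
  "cycle_graph m = \<lparr>pverts = {..<m},
     parcs = {(i, j). i < m \<and> j < m \<and> (j = (i + 1) mod m \<or> i = (j + 1) mod m)}\<rparr>"

definition cartesian_product ::
  "'a pair_pre_digraph \<Rightarrow> 'b pair_pre_digraph \<Rightarrow> ('a \<times> 'b) pair_pre_digraph" (infixr "\<box>" 75) where
  "G \<box> H = \<lparr>pverts = pverts G \<times> pverts H,
     parcs = {((a, b), (c, d)). a \<in> pverts G \<and> c \<in> pverts G \<and> b \<in> pverts H \<and> d \<in> pverts H \<and>
                (a = c \<and> (b, d) \<in> parcs H \<or> b = d \<and> (a, c) \<in> parcs G)}\<rparr>"

lemma pair_graphI:
  assumes "finite (pverts G)" "parcs G \<subseteq> pverts G \<times> pverts G"
    and "\<And>u v. (u, v) \<in> parcs G \<Longrightarrow> (v, u) \<in> parcs G" "\<And>u. (u, u) \<notin> parcs G"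
  shows "pair_graph G"
proof -
  have "finite (parcs G)"
    using assms(1,2) by (meson finite_SigmaI finite_subset)
  moreover have "symmetric (with_proj G)"
    using assms(3) by (auto simp: symmetric_def intro: symI)
  ultimately show ?thesis
    using assms by unfold_locales auto
qed

lemma pair_graph_cycle_graph:
  assumes "m \<ge> 3"
  shows "pair_graph (cycle_graph m)"
  by (rule pair_graphI) (use assms in \<open>auto simp: cycle_graph_def mod_Suc split: if_splits\<close>)

lemma pair_graph_del_edge:
  assumes "pair_graph G"
  shows "pair_graph (del_edge G e)"
proof -
  interpret pair_graph G by fact
  show ?thesis
    by (rule pair_graphI; cases e)
      (use pair_finite_verts in \<open>auto simp: del_edge_def dest: arcs_symmetric wellformed' no_loops'\<close>)
qed

lemma pair_graph_cartesian_product: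
  assumes "pair_graph G" "pair_graph H"
  shows "pair_graph (G \<box> H)"
proof -
  interpret G: pair_graph G by fact
  interpret H: pair_graph H by fact
  show ?thesis
    by (rule pair_graphI)
      (use G.pair_finite_verts H.pair_finite_verts in
        \<open>auto simp: cartesian_product_def dest: G.arcs_symmetric H.arcs_symmetric G.no_loops' H.no_loops'\<close>)
qed

text \<open>The whole vertex set monitors every edge, so the minimum defining \<^const>\<open>meg\<close> is attained.\<close>

lemma MEG_set_pverts:
  assumes "pair_graph G"
  shows "MEG_set G (pverts G)"
proof -
  interpret G: pair_graph G by fact
  have "monitors G (pverts G) (u, v)" if e: "(u, v) \<in> parcs G" for u v
  proof -
    interpret D: pair_graph "del_edge G (u, v)"
      using assms by (rule pair_graph_del_edge)
    have "G.awalk u [(u, v)] v"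
      using e G.in_arcsD1 G.in_arcsD2 by (auto simp: G.awalk_def)
    then have "graph_dist G u v \<le> ereal (G.awalk_cost (\<lambda>_. 1) [(u, v)])"
      unfolding graph_dist_def by (rule G.min_cost_le_walk_cost)
    then have le: "graph_dist G u v \<le> 1"
      by (simp add: one_ereal_def)
    have "2 \<le> graph_dist (del_edge G (u, v)) u v"
      unfolding graph_dist_def D.\<mu>_def
    proof (rule INF_greatest)
      fix p assume "p \<in> {p. D.awalk u p v}"
      then have p: "D.awalk u p v" by simp
      have "u \<noteq> v" using e G.no_loops' by blast
      have cost: "D.awalk_cost (\<lambda>_. 1) p = length p"
        by (induction p) auto
      have "length p \<noteq> 0" using p \<open>u \<noteq> v\<close> by (auto simp: D.awalk_def)
      moreover have "length p \<noteq> 1"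
      proof
        assume "length p = 1"
        then obtain a where "p = [a]" by (auto simp: length_Suc_conv)
        with p have "(u, v) \<in> parcs (del_edge G (u, v))"
          by (cases a) (simp add: D.awalk_Cons_iff D.awalk_Nil_iff)
        then show False by (simp add: del_edge_def)
      qed
      ultimately have "2 \<le> length p" by linarith
      then show "2 \<le> ereal (D.awalk_cost (\<lambda>_. 1) p)"
        by (simp add: cost)
    qed
    moreover have "(1::ereal) < 2"
      by simp
    ultimately have "graph_dist (del_edge G (u, v)) u v \<noteq> graph_dist G u v"
      using le by (metis leD order_less_le_trans)
    then show ?thesis
      unfolding monitors_def using e G.in_arcsD1 G.in_arcsD2 by blast
  qed
  then show ?thesis by (auto simp: MEG_set_def)
qed

lemma ex_MEG_set_card_meg:
  assumes "pair_graph G"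
  shows "\<exists>S. MEG_set G S \<and> card S = meg G"
  unfolding meg_def by (rule LeastI_ex) (use MEG_set_pverts[OF assms] in blast)

end

theory Submission
  imports Defs
begin

text \<open>
  Call the sets of vertices with a fixed first, respectively second, coordinate the rows and the
  columns.  The distance in the torus is the sum of the cyclic distances of the two coordinates.
  Two vertices that differ in both coordinates are joined by two edge-disjoint shortest paths, one
  taking the row steps first and one the column steps first, so they monitor no edge.  Two vertices
  of one row monitor an edge exactly when it lies on the arc of the row between them that is
  strictly shorter than \<open>m / 2\<close>; the same holds for columns.  Hence the edges of a row can only be
  monitored by vertices of that row, and a monitoring set of the torus is a set that meets each row
  and each column in a monitoring set of a cycle.

  Lower bound: if a set meets a row in at most two vertices \<open>p\<close> and \<open>q\<close>, then the edge that
  leaves \<open>p\<close> along the longer of the two arcs between them is not monitored, because a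
  shortest path can use the other arc (\<open>row_edge_not_monitored\<close>).  So each of the \<open>m\<close> rows
  contributes at least three vertices.

  Upper bound: three vertices monitor a whole cycle if the three arcs between them are shorter than
  \<open>m / 2\<close>.  For \<open>m \<ge> 5\<close> the gaps \<open>p\<close>, \<open>p\<close> and \<open>m - 2 * p \<in> {1, 2}\<close> with
  \<open>p = (m - 1) div 2\<close> will do; for \<open>m = 4\<close> the gap \<open>2\<close> is too long.  Three antidiagonals
  of the torus realise this gap pattern in every row and every column at once
  (\<open>MEG_set_three_antidiagonals\<close>).

  Distances are bounded above by explicit walks, and below by potentials, that is, functions on
  the vertices that grow by at most one along each edge (\<open>graph_dist_ge_potential\<close>).
\<close>

section \<open>Walk lengths and distance\<close>

text \<open>
  Walks are traded for powers of the arc relation: concatenation, reversal and images under maps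
  are then facts about relations and need no lists of arcs.
\<close>

lemma relpow_of_awalk:
  assumes "pair_graph G" "pre_digraph.awalk (with_proj G) u p v"
  shows "(u, v) \<in> parcs G ^^ length p"
proof -
  interpret pair_graph G by fact
  show ?thesis using assms(2)
  proof (induction p arbitrary: u)
    case Nil
    then show ?case by (simp add: awalk_Nil_iff)
  next
    case (Cons e p)
    then have "e \<in> parcs G" "fst e = u" "(snd e, v) \<in> parcs G ^^ length p"
      by (auto simp: awalk_Cons_iff)
    then show ?case
      by (metis length_Cons prod.collapse relpow_Suc_I2)
  qed
qed

lemma awalk_of_relpow:
  assumes "pair_graph G" "u \<in> pverts G" "(u, v) \<in> parcs G ^^ n"
  shows "\<exists>p. pre_digraph.awalk (with_proj G) u p v \<and> length p = n"
proof -
  interpret pair_graph G by fact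
  show ?thesis using assms(2,3)
  proof (induction n arbitrary: u)
    case 0
    then show ?case by (auto simp: awalk_Nil_iff)
  next
    case (Suc n)
    then obtain w where w: "(u, w) \<in> parcs G" "(w, v) \<in> parcs G ^^ n"
      by (meson relpow_Suc_D2)
    moreover have "w \<in> pverts G" using w(1) in_arcsD2 by blast
    ultimately obtain p where "awalk w p v" "length p = n"
      using Suc.IH by blast
    with w(1) show ?case
      by (intro exI[of _ "(u, w) # p"]) (auto simp: awalk_Cons_iff in_arcsD1)
  qed
qed

lemma (in wf_digraph) unit_awalk_cost: "awalk_cost (\<lambda>_. 1) p = real (length p)"
  by (induction p) auto

lemma graph_dist_le:
  assumes "pair_graph G" "u \<in> pverts G" "(u, v) \<in> parcs G ^^ n"
  shows "graph_dist G u v \<le> ereal (real n)"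
proof -
  interpret pair_graph G by fact
  obtain p where "awalk u p v" "length p = n"
    using awalk_of_relpow[OF assms] by blast
  then show ?thesis
    unfolding graph_dist_def by (metis min_cost_le_walk_cost unit_awalk_cost)
qed

text \<open>
  Along a walk from \<open>u\<close> to \<open>v\<close> the potential has to climb from \<open>0\<close> to \<open>f v\<close>, by at
  most one in each step.
\<close>

lemma graph_dist_ge_potential:
  fixes f :: "'a \<Rightarrow> nat"
  assumes "pair_graph G" and lip: "\<And>x y. (x, y) \<in> parcs G \<Longrightarrow> f y \<le> f x + 1" and "f u = 0"
  shows "ereal (real (f v)) \<le> graph_dist G u v"
proof -
  interpret pair_graph G by fact
  have le: "f y \<le> f x + n" if "(x, y) \<in> parcs G ^^ n" for n x y
    using that
  proof (induction n arbitrary: y)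
    case (Suc n)
    then obtain z where "(x, z) \<in> parcs G ^^ n" "(z, y) \<in> parcs G" by auto
    with Suc.IH[of z] lip[of z y] show ?case by simp
  qed simp
  show ?thesis
    unfolding graph_dist_def \<mu>_def
  proof (rule INF_greatest)
    fix p assume "p \<in> {p. awalk u p v}"
    then have "f v \<le> length p"
      using le[OF relpow_of_awalk[OF assms(1)], of u p v] \<open>f u = 0\<close> by simp
    then show "ereal (real (f v)) \<le> ereal (awalk_cost (\<lambda>_. 1) p)"
      by (simp add: unit_awalk_cost)
  qed
qed

lemma relpow_map:
  assumes "(u, v) \<in> R ^^ n" "\<And>x y. (x, y) \<in> R \<Longrightarrow> (h x, h y) \<in> Q"
  shows "(h u, h v) \<in> Q ^^ n"
  using assms(1)
proof (induction n arbitrary: v)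
  case (Suc n)
  then show ?case using assms(2) by (auto intro: relcompI)
qed simp

lemma relpow_sym:
  assumes "sym R" "(u, v) \<in> R ^^ n"
  shows "(v, u) \<in> R ^^ n"
  using assms(2)
proof (induction n arbitrary: v)
  case (Suc n)
  then obtain w where "(u, w) \<in> R ^^ n" "(w, v) \<in> R" by auto
  with Suc.IH \<open>sym R\<close> show ?case by (meson relpow_Suc_I2 symE)
qed simp

lemma graph_dist_le_image:
  assumes "pair_graph G" "pair_graph H" "u \<in> pverts G"  "h u \<in> pverts H"
    and h: "\<And>x y. (x, y) \<in> parcs G \<Longrightarrow> (h x, h y) \<in> parcs H"
  shows "graph_dist H (h u) (h v) \<le> graph_dist G u v"
proof -
  interpret G: pair_graph G by fact
  show ?thesis
    unfolding graph_dist_def[of G] G.\<mu>_def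
  proof (rule INF_greatest)
    fix p assume "p \<in> {p. G.awalk u p v}"
    then have "(h u, h v) \<in> parcs H ^^ length p"
      using relpow_map[OF relpow_of_awalk[OF assms(1)], of u p v h, OF _ h] by simp
    then show "graph_dist H (h u) (h v) \<le> ereal (G.awalk_cost (\<lambda>_. 1) p)"
      using graph_dist_le[OF assms(2,4)] by (simp add: G.unit_awalk_cost)
  qed
qed

section \<open>Arcs and distances on a cycle\<close>

text \<open>
  The clockwise offset of \<open>y\<close> from \<open>b\<close> on the cycle, that is \<open>y - b\<close> modulo \<open>m\<close>; the
  case distinction keeps it within linear arithmetic.
\<close>

definition cw :: "nat \<Rightarrow> nat \<Rightarrow> nat \<Rightarrow> nat" where
  "cw m b y = (if b \<le> y then y - b else y + m - b)"

definition cdist :: "nat \<Rightarrow> nat \<Rightarrow> nat \<Rightarrow> nat" where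
  "cdist m b y = min (cw m b y) (m - cw m b y)"

lemma cw_self [simp]: "cw m b b = 0"
  by (simp add: cw_def)

lemma cdist_self [simp]: "cdist m b b = 0"
  by (simp add: cdist_def)

lemma cw_less: "b < m \<Longrightarrow> y < m \<Longrightarrow> cw m b y < m"
  by (auto simp: cw_def)

lemma cw_inject: "b < m \<Longrightarrow> y < m \<Longrightarrow> z < m \<Longrightarrow> cw m b y = cw m b z \<longleftrightarrow> y = z"
  by (auto simp: cw_def)

text \<open>
  Seen from row \<open>x\<close> of the torus: the offset of \<open>y\<close> from the place where the antidiagonal
  \<open>d\<close> meets the row is the offset from \<open>d\<close> of the antidiagonal through \<open>(x, y)\<close>.
\<close>

lemma cw_cw:
  assumes "x < m" "y < m" "d < m"
  shows "cw m (cw m x d) y = cw m d ((x + y) mod m)"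
proof (cases "x + y < m")
  case True
  then show ?thesis using assms by (auto simp: cw_def)
next
  case False
  then have "(x + y) mod m = x + y - m" using assms by (simp add: le_mod_geq)
  then show ?thesis using assms False by (auto simp: cw_def)
qed

lemma add_cw_mod: "x < m \<Longrightarrow> d < m \<Longrightarrow> (x + cw m x d) mod m = d"
  by (auto simp: cw_def)

lemma cw_add_mod: "x < m \<Longrightarrow> y < m \<Longrightarrow> cw m x ((x + y) mod m) = y"
  by (cases "x + y < m") (auto simp: cw_def le_mod_geq)

lemma cw_Suc_mod: "b < m \<Longrightarrow> y < m \<Longrightarrow> cw m b (Suc y mod m) = Suc (cw m b y) mod m"
  by (cases "Suc y = m") (auto simp: cw_def mod_Suc Suc_diff_le)

text \<open>
  The map \<open>h\<close> embeds the cycle into another graph, in the applications as a row or a column of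
  the torus.  Only the edges of the arc from \<open>b\<close> to \<open>c\<close> have to survive in that graph, so the
  lemma also yields walks that avoid an edge on the opposite arc.
\<close>

lemma cw_arc_walk:
  assumes "b < m" "c < m"
    and step: "\<And>y. y < m \<Longrightarrow> cw m b y < cw m b c \<Longrightarrow> (h y, h (Suc y mod m)) \<in> R"
  shows "(h b, h c) \<in> R ^^ cw m b c"
proof -
  have "(h b, h ((b + n) mod m)) \<in> R ^^ n" if "n \<le> cw m b c" for n
    using that
  proof (induction n)
    case (Suc n)
    have "n < m" using Suc.prems assms(1,2) by (auto simp: cw_def split: if_splits)
    then have "cw m b ((b + n) mod m) = n"
      using \<open>b < m\<close> by (cases "b + n < m") (auto simp: cw_def le_mod_geq)
    then have "(h ((b + n) mod m), h (Suc ((b + n) mod m) mod m)) \<in> R"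
      using step[of "(b + n) mod m"] Suc.prems \<open>b < m\<close> by simp
    then show ?case using Suc by (auto simp: mod_Suc_eq intro!: relcompI)
  qed (use assms(1) in simp)
  moreover have "(b + cw m b c) mod m = c"
    using assms(1,2) by (auto simp: cw_def)
  ultimately show ?thesis by (metis order_refl)
qed

lemma cdist_walk:
  assumes "b < m" "c < m" "sym R"
    and step: "\<And>y. y < m \<Longrightarrow> (h y, h (Suc y mod m)) \<in> R"
  shows "(h b, h c) \<in> R ^^ cdist m b c"
proof (cases "cdist m b c = cw m b c")
  case True
  then show ?thesis using cw_arc_walk[of b m c h R] assms by simp
next
  case False
  then have "cdist m b c = cw m c b"
    using assms(1,2) by (auto simp: cdist_def cw_def split: if_splits)
  then show ?thesis using relpow_sym[OF \<open>sym R\<close> cw_arc_walk[of c m b h R]] assms by simp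
qed

section \<open>The torus\<close>

abbreviation torus :: "nat \<Rightarrow> (nat \<times> nat) pair_pre_digraph" where
  "torus m \<equiv> cycle_graph m \<box> cycle_graph m"

lemma pair_graph_torus: "m \<ge> 3 \<Longrightarrow> pair_graph (torus m)"
  by (intro pair_graph_cartesian_product pair_graph_cycle_graph)

lemma pverts_torus: "pverts (torus m) = {..<m} \<times> {..<m}"
  by (simp add: cartesian_product_def cycle_graph_def)

lemma pverts_del_edge [simp]: "pverts (del_edge G e) = pverts G"
  by (simp add: del_edge_def)

lemma parcs_del_edge: "parcs (del_edge G e) = parcs G - {e, prod.swap e}"
  by (simp add: del_edge_def)

lemma sym_parcs:
  assumes "pair_graph G"
  shows "sym (parcs G)"
proof -
  interpret pair_graph G by fact
  show ?thesis using arcs_symmetric by (auto intro: symI)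
qed

lemma torus_row_arc: "x < m \<Longrightarrow> y < m \<Longrightarrow> ((x, y), (x, Suc y mod m)) \<in> parcs (torus m)"
  by (auto simp: cartesian_product_def cycle_graph_def)

lemma torus_column_arc: "x < m \<Longrightarrow> y < m \<Longrightarrow> ((x, y), (Suc x mod m, y)) \<in> parcs (torus m)"
  by (auto simp: cartesian_product_def cycle_graph_def)

lemma torus_arc_cases:
  assumes "((x, y), (x', y')) \<in> parcs (torus m)"
  obtains (row) "x' = x" "y' = Suc y mod m \<or> y = Suc y' mod m" "x < m" "y < m" "y' < m"
  | (column) "y' = y" "x' = Suc x mod m \<or> x = Suc x' mod m" "x < m" "x' < m" "y < m"
proof -
  have "x < m \<and> x' < m \<and> y < m \<and> y' < m \<and>
    (x' = x \<and> (y' = Suc y mod m \<or> y = Suc y' mod m) \<or>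
     y' = y \<and> (x' = Suc x mod m \<or> x = Suc x' mod m))"
    using assms unfolding cartesian_product_def cycle_graph_def
    by (simp only: pair_pre_digraph.simps mem_Collect_eq prod.case lessThan_iff Suc_eq_plus1) blast
  then show thesis using row column by blast
qed

lemma cdist_step:
  assumes "a < m" "x < m" "x' < m" "x' = Suc x mod m \<or> x = Suc x' mod m"
  shows "cdist m a x' \<le> cdist m a x + 1"
  using assms by (auto simp: cdist_def cw_def mod_Suc split: if_splits)

text \<open>
  A torus edge changes one coordinate only, and that by one step on the cycle, so the sum of the
  cyclic distances is a potential.
\<close>

lemma torus_dist_ge:
  assumes "m \<ge> 3" "a < m" "b < m"
  shows "ereal (real (cdist m a x + cdist m b y)) \<le> graph_dist (torus m) (a, b) (x, y)"
proof -
  let ?f = "\<lambda>(x, y). cdist m a x + cdist m b y"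
  have "?f w \<le> ?f v + 1" if "(v, w) \<in> parcs (torus m)" for v w
  proof -
    obtain x y x' y' where vw: "v = (x, y)" "w = (x', y')" by fastforce
    show ?thesis using that[unfolded vw]
      by (cases rule: torus_arc_cases) (use assms cdist_step in \<open>auto simp: vw\<close>)
  qed
  from graph_dist_ge_potential[where f = ?f, OF pair_graph_torus[OF assms(1)] this, where u = "(a, b)" and v = "(x, y)"]
  show ?thesis by simp
qed

section \<open>Three vertices in every row\<close>

text \<open>
  Deleting an edge never shortens a distance; it keeps the distance if a shortest path survives.
\<close>

lemma not_monitorsI:
  assumes G: "pair_graph G" and S: "S \<subseteq> pverts G"
    and walk: "\<And>u v. u \<in> S \<Longrightarrow> v \<in> S \<Longrightarrow>
      \<exists>n. (u, v) \<in> parcs (del_edge G e) ^^ n \<and> ereal (real n) \<le> graph_dist G u v"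
  shows "\<not> monitors G S e"
proof
  assume "monitors G S e"
  then obtain u v where uv: "u \<in> S" "v \<in> S"
    and ne: "graph_dist (del_edge G e) u v \<noteq> graph_dist G u v"
    by (auto simp: monitors_def)
  have D: "pair_graph (del_edge G e)" using G by (rule pair_graph_del_edge)
  have "graph_dist (del_edge G e) u v \<le> graph_dist G u v"
    using walk[OF uv] graph_dist_le[OF D] uv(1) S
    by (metis order_trans pverts_del_edge subsetD)
  moreover have "graph_dist G u v \<le> graph_dist (del_edge G e) u v"
    using graph_dist_le_image[OF D G, where h = "\<lambda>x. x" and u = u and v = v] uv(1) S
    by (auto simp: parcs_del_edge)
  ultimately show False using ne by simp
qed

text \<open>
  The hypothesis \<open>short\<close> says that the clockwise arc from \<open>q\<close> to \<open>p\<close> realises their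
  distance; the edge after \<open>p\<close> lies on the opposite arc, which is nonempty even if \<open>p = q\<close>.
  Any two vertices of \<open>S\<close> have a shortest path that avoids this edge: if one of them lies
  outside row \<open>a\<close>, all row steps can be taken in its row, and if both lie in row \<open>a\<close>, the
  path runs along the short arc.
\<close>

lemma row_edge_not_monitored:
  assumes "m \<ge> 3" and S: "S \<subseteq> pverts (torus m)" and "a < m" "p < m" "q < m"
    and row: "\<And>y. (a, y) \<in> S \<Longrightarrow> y = p \<or> y = q"
    and short: "2 * cw m q p \<le> m"
  shows "\<not> monitors (torus m) S ((a, p), (a, Suc p mod m))"
proof (rule not_monitorsI)
  let ?e = "((a, p), (a, Suc p mod m))"
  let ?R = "parcs (del_edge (torus m) ?e)"
  have G: "pair_graph (torus m)" using assms(1) by (rule pair_graph_torus)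
  then show "pair_graph (torus m)" .
  have symR: "sym ?R" using pair_graph_del_edge[OF G] by (rule sym_parcs)
  have col: "((x, y), (Suc x mod m, y)) \<in> ?R" if "x < m" "y < m" for x y
    using that torus_column_arc[OF that] \<open>m \<ge> 3\<close>
    by (auto simp: parcs_del_edge mod_Suc split: if_splits)
  have row_off: "((x, y), (x, Suc y mod m)) \<in> ?R" if "x < m" "y < m" "x \<noteq> a" for x y
    using that torus_row_arc[OF that(1,2)] by (auto simp: parcs_del_edge)
  have row_on: "((a, y), (a, Suc y mod m)) \<in> ?R" if "y < m" "y \<noteq> p" for y
    using that torus_row_arc[OF \<open>a < m\<close> that(1)] \<open>m \<ge> 3\<close> \<open>p < m\<close>
    by (auto simp: parcs_del_edge mod_Suc split: if_splits)
  show "S \<subseteq> pverts (torus m)" by fact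
  fix u v assume uv: "u \<in> S" "v \<in> S"
  obtain x y x' y' where [simp]: "u = (x, y)" "v = (x', y')" by fastforce
  have lt: "x < m" "y < m" "x' < m" "y' < m" using uv S by (auto simp: pverts_torus)
  have colwalk: "((x, z), (x', z)) \<in> ?R ^^ cdist m x x'" if "z < m" for z
    using cdist_walk[OF lt(1,3) symR, of "\<lambda>x. (x, z)"] col that by blast
  have rowwalk: "((z, y), (z, y')) \<in> ?R ^^ cdist m y y'" if "z < m" "z \<noteq> a" for z
    using cdist_walk[OF lt(2,4) symR, of "\<lambda>y. (z, y)"] row_off that by blast
  have qp: "((a, q), (a, p)) \<in> ?R ^^ cw m q p"
    by (rule cw_arc_walk[where h = "\<lambda>y. (a, y)"]) (use assms row_on in auto)
  have "(u, v) \<in> ?R ^^ (cdist m x x' + cdist m y y')"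
  proof -
    \<comment> \<open>Take the row steps in the row of \<open>u\<close>, in the row of \<open>v\<close>, or along the short arc of row \<open>a\<close>.\<close>
    consider "x \<noteq> a" | "x' \<noteq> a" | "x = a" "x' = a" by blast
    then show ?thesis
    proof cases
      case 1
      have "(u, v) \<in> ?R ^^ (cdist m y y' + cdist m x x')"
        unfolding relpow_add using rowwalk[of x] colwalk[of y'] lt 1 by auto
      then show ?thesis by (simp add: add.commute)
    next
      case 2
      show ?thesis
        unfolding relpow_add using rowwalk[of x'] colwalk[of y] lt 2 by auto
    next
      case 3
      have "cdist m q p = cw m q p" "cdist m p q = cw m q p" "cdist m z z = 0" for z
        using short \<open>p < m\<close> \<open>q < m\<close> by (auto simp: cdist_def cw_def)
      moreover have "y = p \<or> y = q" "y' = p \<or> y' = q" using row uv 3 by auto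
      ultimately show ?thesis
        using qp relpow_sym[OF symR qp] 3 by auto
    qed
  qed
  then show "\<exists>n. (u, v) \<in> ?R ^^ n \<and> ereal (real n) \<le> graph_dist (torus m) u v"
    using torus_dist_ge[OF \<open>m \<ge> 3\<close> lt(1,2), of x' y'] by auto
qed

lemma MEG_set_row_card_ge_3:
  assumes "m \<ge> 3" and MEG: "MEG_set (torus m) S" and "a < m"
  shows "3 \<le> card {y. (a, y) \<in> S}"
proof (rule ccontr)
  let ?Y = "{y. (a, y) \<in> S}"
  assume "\<not> 3 \<le> card ?Y"
  have S: "S \<subseteq> pverts (torus m)" using MEG by (simp add: MEG_set_def)
  then have Y: "?Y \<subseteq> {..<m}" by (auto simp: pverts_torus)
  then have fin: "finite ?Y" using finite_subset by blast
  have "\<exists>p q. p < m \<and> q < m \<and> ?Y \<subseteq> {p, q}"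
  proof -
    consider "card ?Y = 0" | "card ?Y = 1" | "card ?Y = 2"
      using \<open>\<not> 3 \<le> card ?Y\<close> by linarith
    then show ?thesis
    proof cases
      case 1
      then have "?Y = {}" using fin by simp
      then show ?thesis using \<open>a < m\<close> by blast
    next
      case 2
      then obtain p where "?Y = {p}" by (meson card_1_singletonE)
      then show ?thesis using Y by auto
    next
      case 3
      then obtain p q where "?Y = {p, q}" by (meson card_2_iff)
      then show ?thesis using Y by auto
    qed
  qed
  then obtain p q where pq: "p < m" "q < m" "?Y \<subseteq> {p, q}" by blast
  \<comment> \<open>The two offsets add up to \<open>m\<close>, or to \<open>0\<close> if \<open>p = q\<close>.\<close>
  have "2 * cw m q p \<le> m \<or> 2 * cw m p q \<le> m"
    using pq(1,2) by (auto simp: cw_def)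
  then obtain z where "z < m" "\<not> monitors (torus m) S ((a, z), (a, Suc z mod m))"
    using row_edge_not_monitored[OF assms(1) S \<open>a < m\<close>, of p q]
      row_edge_not_monitored[OF assms(1) S \<open>a < m\<close>, of q p] pq by blast
  then show False
    using MEG torus_row_arc[OF \<open>a < m\<close> \<open>z < m\<close>] by (auto simp: MEG_set_def)
qed

lemma card_MEG_set_ge:
  assumes "m \<ge> 3" and MEG: "MEG_set (torus m) S"
  shows "3 * m \<le> card S"
proof -
  have S: "S \<subseteq> {..<m} \<times> {..<m}"
    using MEG by (simp add: MEG_set_def pverts_torus)
  let ?row = "\<lambda>a. {y. (a, y) \<in> S}"
  have fin: "finite (?row a)" for a
    by (rule finite_subset[of _ "{..<m}"]) (use S in auto)
  have "S = (SIGMA a:{..<m}. ?row a)" using S by auto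
  then have "card S = card (SIGMA a:{..<m}. ?row a)" by (rule arg_cong)
  also have "\<dots> = (\<Sum>a<m. card (?row a))" using fin by (simp add: card_SigmaI)
  finally have "card S = (\<Sum>a<m. card (?row a))" .
  moreover have "(\<Sum>a<m. 3) \<le> (\<Sum>a<m. card (?row a))"
    using MEG_set_row_card_ge_3[OF assms] by (intro sum_mono) blast
  ultimately show ?thesis by (simp only: sum_constant card_lessThan mult.commute of_nat_id)
qed

section \<open>A monitoring set with three vertices in every row and column\<close>

text \<open>
  On a row whose edge from offset \<open>t\<close> to offset \<open>t + 1\<close> is deleted, the vertices with
  offsets in \<open>{t<..g}\<close> lie one step further from offset \<open>0\<close> than the cyclic distance tells.
  The only cycle edge along which this potential jumps by two is the deleted one: at the other end
  the edge from \<open>g\<close> to \<open>g + 1\<close> is harmless because \<open>2 * g < m\<close>.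
\<close>

lemma detour_potential_step:
  fixes s t g m :: nat
  assumes "s < m" "s \<noteq> t" "t < g" "2 * g < m" and s': "s' = Suc s mod m"
  defines "k \<equiv> \<lambda>s. min s (m - s) + (if t < s \<and> s \<le> g then 1 else 0)"
  shows "k s' \<le> k s + 1" "k s \<le> k s' + 1"
proof -
  have "s' = Suc s \<and> Suc s < m \<or> s' = 0 \<and> Suc s = m"
    using assms(1) s' by (auto simp: mod_Suc)
  then show "k s' \<le> k s + 1" "k s \<le> k s' + 1"
    using assms(1-4) by (auto simp: k_def min_def)
qed

text \<open>
  With the edge deleted, a path from \<open>b\<close> to \<open>c\<close> has to leave row \<open>x\<close> or to go round the other
  way.  The potential is the torus distance from \<open>(x, b)\<close>, increased by one on the part of the
  short arc that lies behind the deleted edge.  It increases by at most one along each remaining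
  edge, also between row \<open>x\<close> and its neighbours, where the torus distance falls by one when the
  row is entered.  At \<open>(x, c)\<close> it exceeds the distance in the torus.
\<close>

lemma row_edge_monitored:
  assumes "m \<ge> 3" "x < m" "b < m" "c < m" "y < m"
    and short: "2 * cw m b c < m" and on: "cw m b y < cw m b c"
    and "(x, b) \<in> S" "(x, c) \<in> S"
  shows "monitors (torus m) S ((x, y), (x, Suc y mod m))"
proof -
  let ?e = "((x, y), (x, Suc y mod m))"
  let ?k = "\<lambda>z. if cw m b y < cw m b z \<and> cw m b z \<le> cw m b c then 1 else 0 :: nat"
  let ?f = "\<lambda>(w, z). cdist m x w + cdist m b z + (if w = x then ?k z else 0)"
  have G: "pair_graph (torus m)" using assms(1) by (rule pair_graph_torus)
  have "?f v' \<le> ?f v + 1" if vv': "(v, v') \<in> parcs (del_edge (torus m) ?e)" for v v'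
  proof -
    obtain w z w' z' where vw: "v = (w, z)" "v' = (w', z')" by fastforce
    have *: "((w, z), (w', z')) \<in> parcs (torus m)" "((w, z), (w', z')) \<noteq> ?e" "((w', z'), (w, z)) \<noteq> ?e"
      using vv' by (auto simp: vw parcs_del_edge)
    show ?thesis using *(1)
    proof (cases rule: torus_arc_cases)
      case row
      show ?thesis
      proof (cases "w = x")
        case False
        then show ?thesis using cdist_step[of b m z z'] row assms by (simp add: vw)
      next
        case True
        have "cdist m b z' + ?k z' \<le> cdist m b z + ?k z + 1"
          using row(2)
        proof
          assume z': "z' = Suc z mod m"
          then have "z \<noteq> y" using *(2) True row(1) by auto
          then have ne: "cw m b z \<noteq> cw m b y"
            using cw_inject[of b m z y] \<open>b < m\<close> \<open>y < m\<close> row(4,5) by simp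
          have "cw m b z' = Suc (cw m b z) mod m"
            using cw_Suc_mod[of b m z] z' \<open>b < m\<close> row(4,5) by simp
          from detour_potential_step(1)[OF cw_less ne on short this] show ?thesis
            unfolding cdist_def using \<open>b < m\<close> row(4,5) by simp
        next
          assume z: "z = Suc z' mod m"
          then have "z' \<noteq> y" using *(3) True row(1) by auto
          then have ne: "cw m b z' \<noteq> cw m b y"
            using cw_inject[of b m z' y] \<open>b < m\<close> \<open>y < m\<close> row(4,5) by simp
          have "cw m b z = Suc (cw m b z') mod m"
            using cw_Suc_mod[of b m z'] z \<open>b < m\<close> row(4,5) by simp
          from detour_potential_step(2)[OF cw_less ne on short this] show ?thesis
            unfolding cdist_def using \<open>b < m\<close> row(4,5) by simp
        qed
        then show ?thesis using True row(1) by (simp add: vw)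
      qed
    next
      case column
      have "cdist m x w' \<le> cdist m x w + 1"
        using cdist_step column \<open>x < m\<close> by blast
      then have "cdist m x w' + (if w' = x then j else 0) \<le> cdist m x w + (if w = x then j else 0) + 1"
        if "j \<le> 1" for j
        using that by auto
      moreover have "?k z \<le> 1" by simp
      ultimately have "cdist m x w' + (if w' = x then ?k z else 0)
          \<le> cdist m x w + (if w = x then ?k z else 0) + 1" by blast
      then show ?thesis using column(1) by (simp add: vw)
    qed
  qed
  from graph_dist_ge_potential[where f = ?f, OF pair_graph_del_edge[OF G] this,
      where u = "(x, b)" and v = "(x, c)"]
  have "ereal (real (cw m b c + 1)) \<le> graph_dist (del_edge (torus m) ?e) (x, b) (x, c)"
    using short on by (simp add: cdist_def[of m b c])
  moreover have "graph_dist (torus m) (x, b) (x, c) \<le> ereal (real (cw m b c))"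
    by (rule graph_dist_le[OF G])
      (use assms torus_row_arc cw_arc_walk[of b m c "\<lambda>y. (x, y)"] in \<open>auto simp: pverts_torus\<close>)
  ultimately have "graph_dist (del_edge (torus m) ?e) (x, b) (x, c) \<noteq> graph_dist (torus m) (x, b) (x, c)"
    by (metis Suc_eq_plus1 ereal_less_eq(3) not_less_eq_eq of_nat_le_iff order_refl order_trans)
  then show ?thesis using assms by (auto simp: monitors_def)
qed

lemma monitors_swap_edge: "monitors G S (prod.swap e) = monitors G S e"
proof -
  have "del_edge G (prod.swap e) = del_edge G e" by (auto simp: del_edge_def)
  then show ?thesis by (simp add: monitors_def)
qed

lemma torus_swap: "(u, v) \<in> parcs (torus m) \<longleftrightarrow> (prod.swap u, prod.swap v) \<in> parcs (torus m)"
  by (cases u; cases v) (auto simp: cartesian_product_def)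

text \<open>
  Swapping coordinates is an automorphism of the torus; it carries statements on rows to columns.
\<close>

lemma graph_dist_swap:
  assumes "pair_graph G" "pair_graph H" "u \<in> pverts G" "prod.swap u \<in> pverts H"
    and "\<And>x y. (x, y) \<in> parcs G \<longleftrightarrow> (prod.swap x, prod.swap y) \<in> parcs H"
  shows "graph_dist H (prod.swap u) (prod.swap v) = graph_dist G u v"
proof (rule antisym)
  show "graph_dist H (prod.swap u) (prod.swap v) \<le> graph_dist G u v"
    using assms by (intro graph_dist_le_image) auto
  have "graph_dist G (prod.swap (prod.swap u)) (prod.swap (prod.swap v)) \<le>
    graph_dist H (prod.swap u) (prod.swap v)"
    using assms by (intro graph_dist_le_image) auto
  then show "graph_dist G u v \<le> graph_dist H (prod.swap u) (prod.swap v)" by simp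
qed

lemma monitors_torus_swap:
  assumes "m \<ge> 3" "S \<subseteq> pverts (torus m)" "monitors (torus m) S (u, v)"
  shows "monitors (torus m) (prod.swap ` S) (prod.swap u, prod.swap v)"
proof -
  let ?T = "torus m" let ?e = "(u, v)" let ?e' = "(prod.swap u, prod.swap v)"
  have G: "pair_graph ?T" using assms(1) by (rule pair_graph_torus)
  have verts: "s \<in> pverts ?T" "prod.swap s \<in> pverts ?T" if "s \<in> S" for s
    using assms(2) that by (auto simp: pverts_torus)
  have "graph_dist ?T (prod.swap s) (prod.swap t) = graph_dist ?T s t"
    if "s \<in> S" for s t
    using verts[OF that] torus_swap by (intro graph_dist_swap G) auto
  moreover have "graph_dist (del_edge ?T ?e') (prod.swap s) (prod.swap t) = graph_dist (del_edge ?T ?e) s t"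
    if "s \<in> S" for s t
  proof (intro graph_dist_swap pair_graph_del_edge G)
    fix x y
    have "prod.swap x = prod.swap z \<longleftrightarrow> x = z" for x z :: "nat \<times> nat"
      by (metis swap_swap)
    then show "(x, y) \<in> parcs (del_edge ?T ?e) \<longleftrightarrow>
      (prod.swap x, prod.swap y) \<in> parcs (del_edge ?T ?e')"
      using torus_swap[of x y m] by (auto simp: parcs_del_edge)
  qed (use verts that in auto)
  ultimately show ?thesis using assms(3) by (auto simp: monitors_def)
qed

text \<open>
  Antidiagonals rather than diagonals make the set symmetric under swapping coordinates.
\<close>

definition three_antidiagonals :: "nat \<Rightarrow> (nat \<times> nat) set" where
  "three_antidiagonals m =
    {(x, y). x < m \<and> y < m \<and> (x + y) mod m \<in> {0, (m - 1) div 2, 2 * ((m - 1) div 2)}}"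

text \<open>
  A vertex is determined by its row and its antidiagonal.
\<close>

lemma card_three_antidiagonals:
  "card (three_antidiagonals m) \<le> 3 * m"
proof -
  let ?D = "{0, (m - 1) div 2, 2 * ((m - 1) div 2)}"
  let ?g = "\<lambda>(x, y). (x, (x + y) mod m)"
  have "inj_on ?g (three_antidiagonals m)"
  proof (rule inj_onI)
    fix u v
    assume "u \<in> three_antidiagonals m" "v \<in> three_antidiagonals m" "?g u = ?g v"
    then show "u = v"
      using cw_add_mod by (cases u; cases v) (clarsimp simp: three_antidiagonals_def, metis)
  qed
  moreover have "?g ` three_antidiagonals m \<subseteq> {..<m} \<times> ?D"
    by (auto simp: three_antidiagonals_def)
  ultimately have "card (three_antidiagonals m) \<le> card ({..<m} \<times> ?D)"
    by (intro card_inj_on_le) auto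
  also have "\<dots> \<le> 3 * m"
    using card_insert_le_m1[of 3 "{(m - 1) div 2, 2 * ((m - 1) div 2)}" 0]
      card_insert_le_m1[of 2 "{2 * ((m - 1) div 2)}" "(m - 1) div 2"]
    by (simp add: card_cartesian_product)
  finally show ?thesis .
qed

text \<open>
  Cutting the cycle of antidiagonals at \<open>0\<close>, \<open>p\<close> and \<open>2 * p\<close> gives three arcs shorter
  than \<open>m / 2\<close>, and the edge is monitored by the ends of the arc on which its first endpoint lies.
\<close>

lemma row_edge_monitored_by_antidiagonals:
  assumes "m \<ge> 5" "x < m" "y < m"
  shows "monitors (torus m) (three_antidiagonals m) ((x, y), (x, Suc y mod m))"
proof -
  define p where "p = (m - 1) div 2"
  let ?D = "{0, p, 2 * p}" and ?s = "(x + y) mod m"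
  have p: "2 * p < m" "m \<le> 2 * p + 2" "2 \<le> p"
    using assms(1) by (auto simp: p_def)
  have less: "d < m" if "d \<in> ?D" for d
    using that p by auto
  have S: "(x, cw m x d) \<in> three_antidiagonals m" if "d \<in> ?D" for d
    using that less[OF that] assms(2) add_cw_mod[of x m d] cw_less[of x m d]
    by (simp add: three_antidiagonals_def p_def)
  have mon: ?thesis if "d \<in> ?D" "d' \<in> ?D" "2 * cw m d d' < m" "cw m d ?s < cw m d d'" for d d'
  proof (rule row_edge_monitored[of m x "cw m x d" "cw m x d'"])
    show "2 * cw m (cw m x d) (cw m x d') < m"
      "cw m (cw m x d) y < cw m (cw m x d) (cw m x d')"
      using that less assms(2,3) by (simp_all only: cw_cw cw_less add_cw_mod)
  qed (use that S less cw_less assms in auto)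
  have "?s < m" using assms(2) by simp
  then consider "?s < p" | "p \<le> ?s" "?s < 2 * p" | "2 * p \<le> ?s" "?s < m" by linarith
  then show ?thesis
  proof cases
    case 1
    then show ?thesis using p by (intro mon[of 0 p]) (simp_all add: cw_def)
  next
    case 2
    then show ?thesis using p by (intro mon[of p "2 * p"]) (simp_all add: cw_def)
  next
    case 3
    then show ?thesis using p assms(1) by (intro mon[of "2 * p" 0]) (auto simp: cw_def intro!: diff_less_mono)
  qed
qed

lemma MEG_set_three_antidiagonals:
  assumes "m \<ge> 5"
  shows "MEG_set (torus m) (three_antidiagonals m)"
proof -
  let ?S = "three_antidiagonals m"
  have sub: "?S \<subseteq> pverts (torus m)"
    by (auto simp: three_antidiagonals_def pverts_torus)
  have "(x, y) \<in> ?S \<longleftrightarrow> (y, x) \<in> ?S" for x y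
    by (auto simp: three_antidiagonals_def add.commute)
  then have swap: "prod.swap ` ?S = ?S" by force
  have row: "monitors (torus m) ?S ((x, y), (x, Suc y mod m))"
    "monitors (torus m) ?S ((x, Suc y mod m), (x, y))" if "x < m" "y < m" for x y
    using row_edge_monitored_by_antidiagonals[OF assms that]
      monitors_swap_edge[of "torus m" ?S "((x, y), (x, Suc y mod m))"] by auto
  have column: "monitors (torus m) ?S ((y, x), (Suc y mod m, x))"
    "monitors (torus m) ?S ((Suc y mod m, x), (y, x))" if "x < m" "y < m" for x y
    using row[OF that, THEN monitors_torus_swap[rotated 2]] sub assms by (auto simp: swap)
  have "monitors (torus m) ?S ((x, y), (x', y'))" if "((x, y), (x', y')) \<in> parcs (torus m)" for x y x' y'
    using that by (cases rule: torus_arc_cases) (use row column in auto)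
  then show ?thesis using sub by (auto simp: MEG_set_def)
qed

theorem theorem4:
  fixes m :: nat
  assumes "m \<ge> 5"
  shows "meg (cycle_graph m \<box> cycle_graph m) = 3 * m"
proof (rule antisym)
  have "meg (torus m) \<le> card (three_antidiagonals m)"
    unfolding meg_def using MEG_set_three_antidiagonals[OF assms] by (intro Least_le) blast
  then show "meg (torus m) \<le> 3 * m"
    using card_three_antidiagonals[of m] by linarith
  obtain S where "MEG_set (torus m) S" "card S = meg (torus m)"
    using ex_MEG_set_card_meg[OF pair_graph_torus[of m]] assms by auto
  then show "3 * m \<le> meg (torus m)"
    using card_MEG_set_ge[of m S] assms by simp
qed

end
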